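(* Let $v: G \rightarrow [0,\infty[$ be a continuous weight on a planar domain $G$ such that $G\setminus E_v$ is discrete, i.e., the zeros of $v$ are isolated. Then $H^\infty_v(G)$ is a Banach space.
   Context: A planar domain is a (nonempty) open connected subset $G$ of $\mathbb{C}$. A weight on $G$ is a function $v:G\to[0,\infty[$. $E_v:=\{z\in G : v(z)>0\}$. $H(G)$ is the space of holomorphic functions on $G$. $H^\infty_v(G):=\{f\in H(G) : \|f\|_v:=\sup_{z\in G} v(z)|f(z)|<+\infty\}$, endowed with the seminorm $\|\cdot\|_v$; saying it is a Banach space means that $\|\cdot\|_v$ is a norm and is complete. *)

theory Defs
  imports
    "HOL-Complex_Analysis.Complex_Analysis"
    "HOL-Library.Function_Algebras"
begin

definition planar_domain :: "complex set \<Rightarrow> bool"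
  where "planar_domain G \<longleftrightarrow> open G \<and> connected G \<and> G \<noteq> {}"

text \<open>A weight on \<open>G\<close> is a total function of which only the values on \<open>G\<close> matter.\<close>

definition weight_on :: "complex set \<Rightarrow> (complex \<Rightarrow> real) \<Rightarrow> bool"
  where "weight_on G v \<longleftrightarrow> (\<forall>z\<in>G. 0 \<le> v z)"

definition pos_set :: "complex set \<Rightarrow> (complex \<Rightarrow> real) \<Rightarrow> complex set"
  where "pos_set G v = {z \<in> G. v z > 0}"

text \<open>A holomorphic function on \<open>G\<close> is represented by its extension by zero to the whole plane.
  Hence equality in the space is equality on \<open>G\<close>, and the vector space operations are the
  pointwise ones on total functions.\<close>

definition hol_space :: "complex set \<Rightarrow> (complex \<Rightarrow> complex) set"
  where "hol_space G = {f. f holomorphic_on G \<and> (\<forall>z. z \<notin> G \<longrightarrow> f z = 0)}"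

text \<open>The weighted seminorm is a supremum of reals, so it is meaningful only where the
  supremum is finite. Membership in \<open>weighted_hol_space\<close> expresses this finiteness as
  boundedness above.\<close>

definition weighted_norm :: "complex set \<Rightarrow> (complex \<Rightarrow> real) \<Rightarrow> (complex \<Rightarrow> complex) \<Rightarrow> real"
  where "weighted_norm G v f = (SUP z\<in>G. v z * cmod (f z))"

definition weighted_hol_space ::
    "complex set \<Rightarrow> (complex \<Rightarrow> real) \<Rightarrow> (complex \<Rightarrow> complex) set"
  where "weighted_hol_space G v =
    {f \<in> hol_space G. bdd_above ((\<lambda>z. v z * cmod (f z)) ` G)}"

text \<open>\<open>V\<close> is a linear subspace of an ambient complex vector space, and the values of \<open>N\<close>
  outside \<open>V\<close> are irrelevant.\<close>

definition norm_on ::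
    "(complex \<Rightarrow> 'a \<Rightarrow> 'a) \<Rightarrow> 'a::ab_group_add set \<Rightarrow> ('a \<Rightarrow> real) \<Rightarrow> bool"
  where "norm_on smul V N \<longleftrightarrow>
    (\<forall>x\<in>V. 0 \<le> N x) \<and>
    (\<forall>x\<in>V. N x = 0 \<longleftrightarrow> x = 0) \<and>
    (\<forall>c. \<forall>x\<in>V. N (smul c x) = cmod c * N x) \<and>
    (\<forall>x\<in>V. \<forall>y\<in>V. N (x + y) \<le> N x + N y)"

definition complete_norm_on :: "'a::ab_group_add set \<Rightarrow> ('a \<Rightarrow> real) \<Rightarrow> bool"
  where "complete_norm_on V N \<longleftrightarrow>
    (\<forall>s::nat \<Rightarrow> 'a. (\<forall>n. s n \<in> V) \<and>
        (\<forall>e>0. \<exists>k. \<forall>m\<ge>k. \<forall>n\<ge>k. N (s m - s n) < e) \<longrightarrow>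
      (\<exists>l\<in>V. (\<lambda>n. N (s n - l)) \<longlonglongrightarrow> 0))"

definition complex_banach_space_on ::
    "(complex \<Rightarrow> 'a \<Rightarrow> 'a) \<Rightarrow> 'a::ab_group_add set \<Rightarrow> ('a \<Rightarrow> real) \<Rightarrow> bool"
  where "complex_banach_space_on smul V N \<longleftrightarrow>
    vector_space smul \<and> module.subspace smul V \<and> norm_on smul V N \<and> complete_norm_on V N"

end

theory Submission
  imports Defs
begin

text \<open>
  Completeness comes from point evaluations that are bounded locally uniformly: every \<open>z \<in> G\<close>
  has a closed disc around it and a constant \<open>C\<close> with \<open>\<bar>f(w)\<bar> \<le> C \<parallel>f\<parallel>\<^sub>v\<close> for all \<open>w\<close> in the disc
  and all \<open>f\<close> in the space. Such a bound makes the seminorm definite, and it turns a Cauchy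
  sequence into one that is locally uniformly Cauchy on \<open>G\<close>. Its pointwise limit is therefore
  holomorphic, and the weighted estimates pass to the limit point by point
  (\<open>complex_banach_space_on_if_locally_dominated\<close>).

  Where \<open>v\<close> is bounded below by some \<open>m > 0\<close> the bound is trivial, with \<open>C = 1/m\<close>. A zero of \<open>v\<close>
  destroys this, but since the zeros are isolated each point is the centre of a disc whose
  boundary circle carries no zero. By continuity \<open>v\<close> has a positive minimum on this compact circle,
  and the maximum modulus principle carries the bound from the circle into the disc
  (\<open>locally_dominated_if_discrete_zeros\<close>).
\<close>

section \<open>The weighted supremum norm\<close>

lemma weighted_le_weighted_norm:
  assumes "f \<in> weighted_hol_space G v" "z \<in> G"
  shows "v z * cmod (f z) \<le> weighted_norm G v f"
  using assms unfolding weighted_hol_space_def weighted_norm_def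
  by (auto intro: cSUP_upper)

lemma weighted_norm_le:
  assumes "G \<noteq> {}" "\<And>z. z \<in> G \<Longrightarrow> v z * cmod (f z) \<le> B"
  shows "weighted_norm G v f \<le> B"
  using assms unfolding weighted_norm_def by (rule cSUP_least)

lemma weighted_norm_nonneg:
  assumes "weight_on G v" "G \<noteq> {}" "f \<in> weighted_hol_space G v"
  shows "0 \<le> weighted_norm G v f"
proof -
  obtain z where z: "z \<in> G" using assms(2) by blast
  have "0 \<le> v z * cmod (f z)"
    using assms(1) z by (simp add: weight_on_def)
  also have "\<dots> \<le> weighted_norm G v f"
    by (rule weighted_le_weighted_norm[OF assms(3) z])
  finally show ?thesis .
qed

lemma weighted_hol_spaceI:
  assumes "f holomorphic_on G" "\<And>z. z \<notin> G \<Longrightarrow> f z = 0"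
    and "\<And>z. z \<in> G \<Longrightarrow> v z * cmod (f z) \<le> B"
  shows "f \<in> weighted_hol_space G v"
  using assms unfolding weighted_hol_space_def hol_space_def by (auto intro: bdd_aboveI2[where M = B])

lemma weighted_hol_spaceD:
  assumes "f \<in> weighted_hol_space G v"
  shows "f holomorphic_on G" "z \<notin> G \<Longrightarrow> f z = 0"
  using assms unfolding weighted_hol_space_def hol_space_def by auto

lemma weighted_add_le:
  assumes "weight_on G v" "f \<in> weighted_hol_space G v" "g \<in> weighted_hol_space G v" "z \<in> G"
  shows "v z * cmod (f z + g z) \<le> weighted_norm G v f + weighted_norm G v g"
proof -
  have "v z * cmod (f z + g z) \<le> v z * (cmod (f z) + cmod (g z))"
    using assms(1,4) by (intro mult_left_mono norm_triangle_ineq) (auto simp: weight_on_def)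
  also have "\<dots> \<le> weighted_norm G v f + weighted_norm G v g"
    using weighted_le_weighted_norm[OF assms(2,4)] weighted_le_weighted_norm[OF assms(3,4)]
    by (simp add: distrib_left)
  finally show ?thesis .
qed

lemma weighted_scale_le:
  assumes "f \<in> weighted_hol_space G v" "z \<in> G"
  shows "v z * cmod (c * f z) \<le> cmod c * weighted_norm G v f"
  using mult_left_mono[OF weighted_le_weighted_norm[OF assms], of "cmod c"]
  by (simp add: norm_mult mult_ac)

lemma vector_space_pointwise: "vector_space (\<lambda>(c::complex) f (z::'a). c * f z)"
  by unfold_locales (auto simp: fun_eq_iff algebra_simps)

lemma add_in_weighted_hol_space:
  assumes "weight_on G v" "f \<in> weighted_hol_space G v" "g \<in> weighted_hol_space G v"
  shows "f + g \<in> weighted_hol_space G v"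
proof (rule weighted_hol_spaceI)
  show "f + g holomorphic_on G"
    unfolding plus_fun_def
    by (intro holomorphic_intros weighted_hol_spaceD(1)[OF assms(2)] weighted_hol_spaceD(1)[OF assms(3)])
qed (use weighted_add_le[OF assms] weighted_hol_spaceD(2)[OF assms(2)] weighted_hol_spaceD(2)[OF assms(3)] in auto)

lemma scale_in_weighted_hol_space:
  assumes "f \<in> weighted_hol_space G v"
  shows "(\<lambda>z. c * f z) \<in> weighted_hol_space G v"
proof (rule weighted_hol_spaceI)
  show "(\<lambda>z. c * f z) holomorphic_on G"
    by (intro holomorphic_intros weighted_hol_spaceD(1)[OF assms])
qed (use weighted_scale_le[OF assms] weighted_hol_spaceD(2)[OF assms] in auto)

lemma subspace_weighted_hol_space:
  assumes "weight_on G v"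
  shows "module.subspace (\<lambda>(c::complex) f z. c * f z) (weighted_hol_space G v)"
proof -
  interpret vector_space "\<lambda>(c::complex) f (z::complex). c * f z"
    by (rule vector_space_pointwise)
  have "0 \<in> weighted_hol_space G v"
    by (rule weighted_hol_spaceI[where B = 0]) (auto simp: zero_fun_def)
  then show ?thesis
    using add_in_weighted_hol_space[OF assms] scale_in_weighted_hol_space
    by (auto simp: subspace_def)
qed

lemma diff_in_weighted_hol_space:
  assumes "weight_on G v" "f \<in> weighted_hol_space G v" "g \<in> weighted_hol_space G v"
  shows "f - g \<in> weighted_hol_space G v"
proof -
  interpret vector_space "\<lambda>(c::complex) f (z::complex). c * f z"
    by (rule vector_space_pointwise)
  show ?thesis
    by (rule subspace_diff[OF subspace_weighted_hol_space[OF assms(1)] assms(2,3)])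
qed

lemma weighted_norm_scale:
  assumes "G \<noteq> {}" "f \<in> weighted_hol_space G v"
  shows "weighted_norm G v (\<lambda>z. c * f z) = cmod c * weighted_norm G v f"
proof (rule antisym)
  show "weighted_norm G v (\<lambda>z. c * f z) \<le> cmod c * weighted_norm G v f"
    by (rule weighted_norm_le[OF assms(1) weighted_scale_le[OF assms(2)]])
next
  \<comment> \<open>For \<open>c \<noteq> 0\<close> this is the previous inequality for the function \<open>c f\<close> and the scalar \<open>1/c\<close>.\<close>
  show "cmod c * weighted_norm G v f \<le> weighted_norm G v (\<lambda>z. c * f z)"
  proof (cases "c = 0")
    case True
    then show ?thesis using assms(1) by (simp add: weighted_norm_def)
  next
    case False
    have "weighted_norm G v f = weighted_norm G v (\<lambda>z. inverse c * (c * f z))"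
      using False by (simp add: mult.assoc[symmetric])
    also have "\<dots> \<le> cmod (inverse c) * weighted_norm G v (\<lambda>z. c * f z)"
      by (rule weighted_norm_le[OF assms(1)
            weighted_scale_le[OF scale_in_weighted_hol_space[OF assms(2)]]])
    finally show ?thesis using False by (simp add: norm_inverse norm_divide field_simps)
  qed
qed

section \<open>Local domination of point evaluations implies completeness\<close>

definition locally_dominated :: "complex set \<Rightarrow> (complex \<Rightarrow> real) \<Rightarrow> bool"
  where "locally_dominated G v \<longleftrightarrow>
    (\<forall>z\<in>G. \<exists>r>0. \<exists>C>0. cball z r \<subseteq> G \<and>
      (\<forall>f\<in>weighted_hol_space G v. \<forall>w\<in>cball z r. cmod (f w) \<le> C * weighted_norm G v f))"

lemma norm_on_weighted_norm:
  assumes "weight_on G v" "G \<noteq> {}" "locally_dominated G v"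
  shows "norm_on (\<lambda>c f z. c * f z) (weighted_hol_space G v) (weighted_norm G v)"
proof -
  have zero: "f = 0" if f: "f \<in> weighted_hol_space G v" and N: "weighted_norm G v f = 0" for f
  proof
    fix z
    show "f z = 0 z"
    proof (cases "z \<in> G")
      case True
      then obtain r C where "r > 0" "\<forall>w\<in>cball z r. cmod (f w) \<le> C * weighted_norm G v f"
        using assms(3) f unfolding locally_dominated_def by blast
      then show ?thesis using N by force
    qed (simp add: weighted_hol_spaceD(2)[OF f])
  qed
  moreover have "weighted_norm G v 0 = 0"
    using assms(2) by (simp add: weighted_norm_def)
  moreover have "weighted_norm G v (f + g) \<le> weighted_norm G v f + weighted_norm G v g"
    if "f \<in> weighted_hol_space G v" "g \<in> weighted_hol_space G v" for f g
    using weighted_add_le[OF assms(1) that] by (intro weighted_norm_le[OF assms(2)]) simp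
  ultimately show ?thesis
    unfolding norm_on_def
    using weighted_norm_nonneg[OF assms(1,2)] weighted_norm_scale[OF assms(2)] by blast
qed

lemma uniform_limit_of_weighted_Cauchy:
  assumes s: "\<And>n. s n \<in> weighted_hol_space G v" "weight_on G v"
    and Cauchy: "\<And>e. e > 0 \<Longrightarrow> \<exists>k. \<forall>m\<ge>k. \<forall>n\<ge>k. weighted_norm G v (s m - s n) < e"
    and C: "C > 0" "\<And>f w. f \<in> weighted_hol_space G v \<Longrightarrow> w \<in> X \<Longrightarrow>
      cmod (f w) \<le> C * weighted_norm G v f"
  shows "uniform_limit X s (\<lambda>z. lim (\<lambda>n. s n z)) sequentially"
  unfolding uniformly_convergent_uniform_limit_iff[symmetric]
proof (rule Cauchy_uniformly_convergent, unfold uniformly_Cauchy_on_def, intro allI impI)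
  fix e :: real assume "e > 0"
  then obtain k where k: "\<And>m n. m \<ge> k \<Longrightarrow> n \<ge> k \<Longrightarrow> weighted_norm G v (s m - s n) < e / C"
    using Cauchy[of "e / C"] C(1) by auto
  have "dist (s m x) (s n x) < e" if "x \<in> X" "m \<ge> k" "n \<ge> k" for x m n
  proof -
    have "dist (s m x) (s n x) \<le> C * weighted_norm G v (s m - s n)"
      using C(2)[OF diff_in_weighted_hol_space[OF s(2) s(1) s(1)] that(1)]
      by (simp add: dist_norm)
    also have "\<dots> < e"
      using k[OF that(2,3)] C(1) by (simp add: field_simps)
    finally show ?thesis .
  qed
  then show "\<exists>M. \<forall>x\<in>X. \<forall>m\<ge>M. \<forall>n\<ge>M. dist (s m x) (s n x) < e" by blast
qed

text \<open>
  The limit of a Cauchy sequence exists pointwise and is holomorphic by local domination.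
  Convergence in the weighted norm follows without further uniformity: the estimate
  \<open>v(z) \<bar>s\<^sub>n(z) - s\<^sub>m(z)\<bar> \<le> e\<close> holds for each \<open>z\<close> with the same indices, so \<open>m\<close> may tend to infinity
  at each \<open>z\<close> separately.
\<close>

lemma complete_norm_on_if_locally_dominated:
  assumes "open G" "G \<noteq> {}" "weight_on G v" "locally_dominated G v"
  shows "complete_norm_on (weighted_hol_space G v) (weighted_norm G v)"
  unfolding complete_norm_on_def
proof (intro allI impI, elim conjE)
  let ?V = "weighted_hol_space G v" and ?N = "weighted_norm G v"
  fix s :: "nat \<Rightarrow> complex \<Rightarrow> complex"
  assume "\<forall>n. s n \<in> ?V" and
    Cauchy: "\<forall>e>0. \<exists>k. \<forall>m\<ge>k. \<forall>n\<ge>k. ?N (s m - s n) < e"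
  then have s: "s n \<in> ?V" for n by blast
  define l where "l = (\<lambda>z. lim (\<lambda>n. s n z))"

  have local_limit: "\<exists>r>0. cball z r \<subseteq> G \<and> uniform_limit (cball z r) s l sequentially"
    if "z \<in> G" for z
  proof -
    from assms(4) that obtain r C where "r > 0" "cball z r \<subseteq> G" and C: "C > 0"
      "\<And>f w. f \<in> ?V \<Longrightarrow> w \<in> cball z r \<Longrightarrow> cmod (f w) \<le> C * ?N f"
      unfolding locally_dominated_def by meson
    moreover have "uniform_limit (cball z r) s l sequentially"
      unfolding l_def
      by (rule uniform_limit_of_weighted_Cauchy[OF s assms(3) _ C]) (use Cauchy in auto)
    ultimately show ?thesis by blast
  qed
  have l_hol: "l holomorphic_on G"
    by (rule holomorphic_uniform_sequence[OF assms(1) weighted_hol_spaceD(1)[OF s] local_limit])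
  have l_limit: "(\<lambda>n. s n z) \<longlonglongrightarrow> l z" if "z \<in> G" for z
  proof -
    obtain r where "r > 0" "uniform_limit (cball z r) s l sequentially"
      using local_limit[OF \<open>z \<in> G\<close>] by blast
    then show ?thesis by (intro tendsto_uniform_limitI) auto
  qed
  have l_zero: "l z = 0" if "z \<notin> G" for z
    using weighted_hol_spaceD(2)[OF s that] by (simp add: l_def)

  have close: "\<exists>k. \<forall>n\<ge>k. \<forall>z\<in>G. v z * cmod (s n z - l z) \<le> e" if "e > 0" for e
  proof -
    obtain k where k: "\<And>m n. m \<ge> k \<Longrightarrow> n \<ge> k \<Longrightarrow> ?N (s m - s n) < e"
      using Cauchy \<open>e > 0\<close> by meson
    have "v z * cmod (s n z - l z) \<le> e" if "n \<ge> k" "z \<in> G" for n z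
    proof (rule LIMSEQ_le_const2)
      show "(\<lambda>m. v z * cmod (s n z - s m z)) \<longlonglongrightarrow> v z * cmod (s n z - l z)"
        by (intro tendsto_intros l_limit[OF that(2)])
      have "v z * cmod (s n z - s m z) \<le> e" if "m \<ge> k" for m
        using weighted_le_weighted_norm[OF diff_in_weighted_hol_space[OF assms(3) s s] \<open>z \<in> G\<close>, of n m]
          k[OF \<open>n \<ge> k\<close> that] by simp
      then show "\<exists>M. \<forall>m\<ge>M. v z * cmod (s n z - s m z) \<le> e" by blast
    qed
    then show ?thesis by blast
  qed

  \<comment> \<open>Any one \<open>s k\<close> at finite weighted distance from \<open>l\<close> shows that \<open>l\<close> has finite norm.\<close>
  obtain k where k: "\<And>z. z \<in> G \<Longrightarrow> v z * cmod (s k z - l z) \<le> 1"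
    using close[of 1] by auto
  have "s k - l \<in> ?V"
  proof (rule weighted_hol_spaceI)
    show "s k - l holomorphic_on G"
      unfolding fun_diff_def
      by (intro holomorphic_intros weighted_hol_spaceD(1)[OF s] l_hol)
  qed (use k l_zero weighted_hol_spaceD(2)[OF s] in auto)
  then have "s k - (s k - l) \<in> ?V"
    by (rule diff_in_weighted_hol_space[OF assms(3) s])
  then have l: "l \<in> ?V" by simp

  have "(\<lambda>n. ?N (s n - l)) \<longlonglongrightarrow> 0"
  proof (rule LIMSEQ_I)
    fix e :: real assume "e > 0"
    then obtain k where k: "\<And>n z. n \<ge> k \<Longrightarrow> z \<in> G \<Longrightarrow> v z * cmod (s n z - l z) \<le> e / 2"
      using close[of "e / 2"] by auto
    have "norm (?N (s n - l) - 0) < e" if "n \<ge> k" for n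
    proof -
      have "?N (s n - l) \<le> e / 2"
        using k[OF that] by (intro weighted_norm_le[OF assms(2)]) simp
      moreover have "0 \<le> ?N (s n - l)"
        by (rule weighted_norm_nonneg[OF assms(3,2) diff_in_weighted_hol_space[OF assms(3) s l]])
      ultimately show ?thesis using \<open>e > 0\<close> by simp
    qed
    then show "\<exists>k. \<forall>n\<ge>k. norm (?N (s n - l) - 0) < e" by blast
  qed
  with l show "\<exists>l\<in>?V. (\<lambda>n. ?N (s n - l)) \<longlonglongrightarrow> 0" by blast
qed

lemma complex_banach_space_on_if_locally_dominated:
  assumes "open G" "G \<noteq> {}" "weight_on G v" "locally_dominated G v"
  shows "complex_banach_space_on (\<lambda>c f z. c * f z)
    (weighted_hol_space G v) (weighted_norm G v)"
  unfolding complex_banach_space_on_def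
  using vector_space_pointwise subspace_weighted_hol_space[OF assms(3)]
    norm_on_weighted_norm[OF assms(3,2,4)] complete_norm_on_if_locally_dominated[OF assms]
  by blast

section \<open>Isolated zeros of the weight\<close>

text \<open>
  If the centre is not a zero of the weight, then continuity keeps the zeros away from it;
  if it is a zero, then discreteness does. Hence small punctured discs are free of zeros.
\<close>

lemma cball_with_zero_free_boundary:
  assumes "open G" "continuous_on G v" "weight_on G v" "discrete (G - pos_set G v)" "z \<in> G"
  obtains r where "r > 0" "cball z r \<subseteq> G" "\<And>w. w \<in> sphere z r \<Longrightarrow> v w > 0"
proof -
  have zeros: "v w > 0" if "w \<in> G" "w \<notin> G - pos_set G v" for w
    using that by (auto simp: pos_set_def)
  have "eventually (\<lambda>w. w \<notin> G - pos_set G v) (at z)"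
  proof (cases "v z > 0")
    case True
    have "(v \<longlongrightarrow> v z) (at z)"
      using assms(1,2,5) by (metis continuous_on_eq_continuous_at isContD)
    then have "eventually (\<lambda>w. v w > 0) (at z)"
      using True by (rule order_tendstoD(1))
    then show ?thesis by eventually_elim (simp add: pos_set_def)
  next
    case False
    then show ?thesis
      using assms(4,5) by (auto simp: discrete_def isolated_in_altdef pos_set_def)
  qed
  then obtain d where d: "d > 0" "\<And>w. w \<noteq> z \<Longrightarrow> dist w z < d \<Longrightarrow> w \<notin> G - pos_set G v"
    by (auto simp: eventually_at)
  obtain e where e: "e > 0" "cball z e \<subseteq> G"
    using assms(1,5) by (auto simp: open_contains_cball)
  define r where "r = min (d / 2) e"
  have "r > 0" using d(1) e(1) by (simp add: r_def)
  moreover have sub: "cball z r \<subseteq> G" using e(2) by (auto simp: r_def)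
  moreover have "v w > 0" if "w \<in> sphere z r" for w
  proof (rule zeros)
    show "w \<in> G" using that sub by auto
    have "dist w z = r" using that by (simp add: dist_commute)
    then show "w \<notin> G - pos_set G v"
      using \<open>r > 0\<close> d(1) by (intro d(2)) (auto simp: r_def)
  qed
  ultimately show thesis by (rule that)
qed

lemma locally_dominated_if_discrete_zeros:
  assumes "open G" "continuous_on G v" "weight_on G v" "discrete (G - pos_set G v)"
  shows "locally_dominated G v"
  unfolding locally_dominated_def
proof
  fix z assume "z \<in> G"
  then obtain r where r: "r > 0" "cball z r \<subseteq> G" and pos: "\<And>w. w \<in> sphere z r \<Longrightarrow> v w > 0"
    using cball_with_zero_free_boundary[OF assms] by blast
  have sub: "sphere z r \<subseteq> G" using r(2) sphere_cball by blast
  obtain y where y: "y \<in> sphere z r" "\<And>w. w \<in> sphere z r \<Longrightarrow> v y \<le> v w"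
    using continuous_attains_inf[of "sphere z r" v] continuous_on_subset[OF assms(2) sub] r(1)
    by auto
  have "cmod (f w) \<le> inverse (v y) * weighted_norm G v f"
    if f: "f \<in> weighted_hol_space G v" and w: "w \<in> cball z r" for f w
  proof (rule maximum_modulus_frontier[OF _ _ _ _ w])
    have hol: "f holomorphic_on cball z r"
      using weighted_hol_spaceD(1)[OF f] r(2) by (rule holomorphic_on_subset)
    then show "f holomorphic_on interior (cball z r)"
      using interior_subset by (rule holomorphic_on_subset)
    show "continuous_on (closure (cball z r)) f"
      using holomorphic_on_imp_continuous_on[OF hol] by simp
    fix u assume "u \<in> frontier (cball z r)"
    then have u: "u \<in> sphere z r" by simp
    have "v y * cmod (f u) \<le> v u * cmod (f u)"
      by (rule mult_right_mono[OF y(2)[OF u]]) simp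
    also have "\<dots> \<le> weighted_norm G v f"
      using u sub by (intro weighted_le_weighted_norm[OF f]) blast
    finally show "cmod (f u) \<le> inverse (v y) * weighted_norm G v f"
      using pos[OF y(1)] by (simp add: field_simps)
  qed simp
  moreover have "inverse (v y) > 0" using pos[OF y(1)] by simp
  ultimately show "\<exists>r>0. \<exists>C>0. cball z r \<subseteq> G \<and>
      (\<forall>f\<in>weighted_hol_space G v. \<forall>w\<in>cball z r. cmod (f w) \<le> C * weighted_norm G v f)"
    using r by blast
qed

theorem corollary3p7:
  fixes G :: "complex set" and v :: "complex \<Rightarrow> real"
  assumes "planar_domain G"
    and "weight_on G v"
    and "continuous_on G v"
    and "discrete (G - pos_set G v)"
  shows "complex_banach_space_on (\<lambda>c f z. c * f z)
    (weighted_hol_space G v) (weighted_norm G v)"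
proof -
  have G: "open G" "G \<noteq> {}"
    using assms(1) by (auto simp: planar_domain_def)
  show ?thesis
    by (rule complex_banach_space_on_if_locally_dominated[OF G assms(2)
          locally_dominated_if_discrete_zeros[OF G(1) assms(3,2,4)]])
qed

end
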